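(* Consider three projectors $P_1,P_2,P_3$ on a Hilbert space such that for each $i\in\{1,2,3\}$ one can write $P_i=\sum_{s=1}^{S_i}P_i^{s}$, where for each $i$ the $\{P_i^s\}_{s}$ are orthogonal projectors, meaning that $P_i^sP_i^{s'}=\delta_{s,s'}P_i^s$. Let $\sigma$ be any quantum state on this space. Let $$V=\frac13\sum_{i=1}^3\mathrm{tr}(P_i\sigma)$$ and $$E=\frac12\left(\sum_{s_3=1}^{S_3}\sum_{s_2=1}^{S_2}\sum_{s_1=1}^{S_1}\mathrm{tr}\left(P_3^{s_3}P_2^{s_2}P_1^{s_1}\,\sigma\, P_1^{s_1}P_2^{s_2}\right)+\sum_{s_3=1}^{S_3}\sum_{s_2=1}^{S_2}\sum_{s_1=1}^{S_1}\mathrm{tr}\left(P_3^{s_3}P_1^{s_1}P_2^{s_2}\,\sigma\, P_2^{s_2}P_1^{s_1}\right)\right).$$ Then $$E\ge\frac{9\left(V-\frac23\right)^4}{2S_1S_2}.$$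
   Context: A projector is a self-adjoint idempotent operator. A quantum state (possibly mixed) is a positive semidefinite operator of trace $1$. $S_1,S_2,S_3$ are positive integers, and $\delta_{s,s'}$ is $1$ if $s=s'$ and $0$ otherwise.
   Formalization: The formal theorem adds the assumption V ≥ 2/3; without it the claim is false: for P_1=P_2=P_3=0 and all S_i=1 one has V=E=0, while the right-hand side is 8/9. *)

theory Defs
  imports "HOL-Analysis.Analysis"
begin

text \<open>
  Complex Hilbert spaces of arbitrary (also infinite) dimension. The inner product is linear in its
  second argument. Positive definiteness is implied by \<open>norm_eq_sqrt_cinner\<close> and the norm axioms,
  and \<open>scaleC 1 x = x\<close> by \<open>scaleR_scaleC\<close>; completeness is part of \<^class>\<open>banach\<close>.
\<close>

class chilbert_space = banach +
  fixes scaleC :: "complex \<Rightarrow> 'a \<Rightarrow> 'a"  (infixr \<open>*\<^sub>C\<close> 75)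
    and cinner :: "'a \<Rightarrow> 'a \<Rightarrow> complex"
  assumes scaleC_add_right: "a *\<^sub>C (x + y) = a *\<^sub>C x + a *\<^sub>C y"
    and scaleC_add_left: "(a + b) *\<^sub>C x = a *\<^sub>C x + b *\<^sub>C x"
    and scaleC_scaleC: "a *\<^sub>C (b *\<^sub>C x) = (a * b) *\<^sub>C x"
    and scaleR_scaleC: "r *\<^sub>R x = complex_of_real r *\<^sub>C x"
    and cinner_commute: "cinner x y = cnj (cinner y x)"
    and cinner_add_right: "cinner x (y + z) = cinner x y + cinner x z"
    and cinner_scaleC_right: "cinner x (a *\<^sub>C y) = a * cinner x y"
    and norm_eq_sqrt_cinner: "norm x = sqrt (Re (cinner x x))"

instantiation complex :: chilbert_space
begin

definition scaleC_complex :: "complex \<Rightarrow> complex \<Rightarrow> complex"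
  where "scaleC_complex a x = a * x"

definition cinner_complex :: "complex \<Rightarrow> complex \<Rightarrow> complex"
  where "cinner_complex x y = cnj x * y"

instance
  by intro_classes
    (auto simp: scaleC_complex_def cinner_complex_def algebra_simps scaleR_conv_of_real
      cmod_def power2_eq_square)

end

text \<open>
  \<^typ>\<open>'a \<Rightarrow>\<^sub>L 'a\<close> is the type of bounded real-linear operators, so complex homogeneity
  is a separate requirement.
\<close>

definition complex_linear :: "('a::chilbert_space \<Rightarrow>\<^sub>L 'a) \<Rightarrow> bool"
  where "complex_linear A \<longleftrightarrow> (\<forall>a x. A (a *\<^sub>C x) = a *\<^sub>C A x)"

definition self_adjoint :: "('a::chilbert_space \<Rightarrow>\<^sub>L 'a) \<Rightarrow> bool"
  where "self_adjoint A \<longleftrightarrow> (\<forall>x y. cinner (A x) y = cinner x (A y))"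

definition projector :: "('a::chilbert_space \<Rightarrow>\<^sub>L 'a) \<Rightarrow> bool"
  where "projector A \<longleftrightarrow> complex_linear A \<and> self_adjoint A \<and> A o\<^sub>L A = A"

definition positive_semidefinite :: "('a::chilbert_space \<Rightarrow>\<^sub>L 'a) \<Rightarrow> bool"
  where "positive_semidefinite A \<longleftrightarrow>
    complex_linear A \<and> self_adjoint A \<and> (\<forall>x. 0 \<le> Re (cinner x (A x)))"

definition orthonormal_basis :: "'a::chilbert_space set \<Rightarrow> bool"
  where "orthonormal_basis B \<longleftrightarrow>
    (\<forall>b\<in>B. \<forall>c\<in>B. cinner b c = (if b = c then 1 else 0)) \<and>
    (\<forall>x. (\<forall>b\<in>B. cinner b x = 0) \<longrightarrow> x = 0)"

text \<open>
  For trace-class operators the sum does not depend on the chosen basis. If the sum over the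
  chosen basis does not converge, the value is \<open>0\<close>; hence a positive semidefinite operator
  with trace \<open>1\<close> is automatically trace class.
\<close>

definition tr :: "('a::chilbert_space \<Rightarrow>\<^sub>L 'a) \<Rightarrow> complex"
  where "tr A = (\<Sum>\<^sub>\<infinity>b\<in>(SOME B. orthonormal_basis B). cinner b (A b))"

definition quantum_state :: "('a::chilbert_space \<Rightarrow>\<^sub>L 'a) \<Rightarrow> bool"
  where "quantum_state A \<longleftrightarrow> positive_semidefinite A \<and> tr A = 1"

end

theory Submission imports Defs begin

text \<open>
  Write \<open>\<sigma> = R\<^sup>2\<close> with \<open>R\<close> self-adjoint. Along an orthonormal basis \<open>B\<close>, the vectors
  \<open>\<psi>\<^sub>b = R b\<close> form an ensemble for \<open>\<sigma>\<close>: every trace of the theorem is a sum of squared norms of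
  images of the \<open>\<psi>\<^sub>b\<close>, so it suffices to argue with single vectors.

  For a vector \<open>v\<close> put \<open>a = P\<^sub>1 v\<close>, \<open>c = P\<^sub>2 a\<close>, \<open>x = P\<^sub>3 c\<close>. Since \<open>a - c\<close> and \<open>c - x\<close> lie in the
  kernels of \<open>P\<^sub>2\<close> and \<open>P\<^sub>3\<close>, splitting \<open>\<langle>a, v\<rangle> = \<parallel>a\<parallel>\<^sup>2\<close> along \<open>a = x + (a - c) + (c - x)\<close> and using
  \<open>2 Re \<langle>u, w\<rangle> \<le> \<parallel>u\<parallel>\<^sup>2 + \<parallel>w\<parallel>\<^sup>2\<close> for the last two summands gives
  \<open>\<Sum>\<^sub>i \<parallel>P\<^sub>i v\<parallel>\<^sup>2 - 2 \<parallel>v\<parallel>\<^sup>2 \<le> 2 Re \<langle>x, v\<rangle>\<close>. With \<open>t = 3 V - 2\<close>, summation over the ensemble and a weighted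
  AM-GM yield \<open>\<Sum>\<^sub>b \<parallel>P\<^sub>3 P\<^sub>2 P\<^sub>1 \<psi>\<^sub>b\<parallel>\<^sup>2 \<ge> t\<^sup>2 / 4\<close>. Refining \<open>P\<^sub>1\<close> and \<open>P\<^sub>2\<close> costs the factor \<open>S\<^sub>1 S\<^sub>2\<close> by
  Cauchy-Schwarz, and \<open>t\<^sup>2 \<ge> t\<^sup>4\<close> because \<open>0 \<le> t \<le> 1\<close>. The resulting bound \<open>t\<^sup>2 / (4 S\<^sub>1 S\<^sub>2)\<close> is stronger
  than the stated one.
\<close>

subsection \<open>Orthonormal bases\<close>

lemma cinner_self: "cinner x x = complex_of_real ((norm x)\<^sup>2)" for x :: "'a::chilbert_space"
proof -
  have "cnj (cinner x x) = cinner x x" by (metis cinner_commute)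
  then have im: "Im (cinner x x) = 0" by (simp add: complex_eq_iff)
  have "0 \<le> Re (cinner x x)"
    using norm_eq_sqrt_cinner[of x] norm_ge_zero[of x] by (metis real_sqrt_ge_0_iff)
  then have "Re (cinner x x) = (norm x)\<^sup>2"
    by (simp add: norm_eq_sqrt_cinner)
  with im show ?thesis by (simp add: complex_eq_iff)
qed

lemma cinner_add_left: "cinner (x + y) z = cinner x z + cinner y (z::'a::chilbert_space)"
  by (metis cinner_add_right cinner_commute complex_cnj_add)

lemma cinner_scaleC_left: "cinner (a *\<^sub>C x) z = cnj a * cinner x (z::'a::chilbert_space)"
  by (metis cinner_scaleC_right cinner_commute complex_cnj_mult)

lemma cinner_scaleR_right: "cinner x (r *\<^sub>R z) = r *\<^sub>R cinner x (z::'a::chilbert_space)"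
  by (simp add: scaleR_scaleC[of r z] cinner_scaleC_right scaleR_conv_of_real)

lemma cinner_scaleR_left: "cinner (r *\<^sub>R x) z = r *\<^sub>R cinner x (z::'a::chilbert_space)"
  by (simp add: scaleR_scaleC[of r x] cinner_scaleC_left scaleR_conv_of_real)

text \<open>Discriminant argument for the form <x, T y>. It is needed twice: with the identity it is
  the usual Cauchy-Schwarz inequality, and with a positive operator it yields the contraction bound
  behind the square root.\<close>

lemma cinner_Cauchy_Schwarz_form:
  fixes T :: "'a::chilbert_space \<Rightarrow> 'a"
  assumes add: "\<And>x y. T (x + y) = T x + T y" and scale: "\<And>a x. T (a *\<^sub>C x) = a *\<^sub>C T x"
    and sym: "\<And>x y. cinner (T x) y = cinner x (T y)"
    and pos: "\<And>x. 0 \<le> Re (cinner x (T x))"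
  shows "(cmod (cinner x (T y)))\<^sup>2 \<le> Re (cinner x (T x)) * Re (cinner y (T y))"
proof -
  define c where "c = cinner x (T y)"
  have c': "cinner y (T x) = cnj c" unfolding c_def by (metis cinner_commute sym)
  define p q where "p = Re (cinner x (T x))" and "q = Re (cinner y (T y))"
  have pq: "0 \<le> p" "0 \<le> q" using pos by (auto simp: p_def q_def)
  have expand: "0 \<le> p + 2 * s * (cmod c)\<^sup>2 + s\<^sup>2 * (cmod c)\<^sup>2 * q" for s :: real
  proof -
    \<comment> \<open>The factor \<open>cnj c\<close> makes the cross terms real, each equal to
      \<open>s\<close> times the squared modulus of \<open>c\<close>.\<close>
    define a where "a = complex_of_real s * cnj c"
    have imq: "Im (cinner y (T y)) = 0"
    proof -
      have "cnj (cinner y (T y)) = cinner y (T y)"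
        using sym[of y y] cinner_commute[of "T y" y] by simp
      then show ?thesis by (simp add: complex_eq_iff)
    qed
    have "0 \<le> Re (cinner (x + a *\<^sub>C y) (T (x + a *\<^sub>C y)))" by (rule pos)
    also have "cinner (x + a *\<^sub>C y) (T (x + a *\<^sub>C y))
        = cinner x (T x) + a * c + cnj a * cnj c + (a * cnj a) * cinner y (T y)"
      by (simp add: add scale cinner_add_left cinner_add_right cinner_scaleC_left
          cinner_scaleC_right c' algebra_simps flip: c_def)
    also have "Re \<dots> = p + 2 * s * (cmod c)\<^sup>2 + s\<^sup>2 * (cmod c)\<^sup>2 * q"
      unfolding a_def p_def q_def cmod_power2
      by (simp add: imq power2_eq_square algebra_simps)
    finally show ?thesis .
  qed
  have "(cmod c)\<^sup>2 \<le> p * q"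
  proof (cases "c = 0")
    case True
    then show ?thesis using pq by simp
  next
    case False
    then have cpos: "0 < (cmod c)\<^sup>2" by simp
    show ?thesis
    proof (cases "q = 0")
      case True
      \<comment> \<open>For \<open>q = 0\<close> the bound is affine in \<open>s\<close> with
        positive slope; this \<open>s\<close> pushes it down to \<open>- p - 2 < 0\<close>, a
        contradiction. For \<open>q > 0\<close> the value \<open>- 1 / q\<close> used below is the
        minimiser.\<close>
      have "p + 2 * (- (p + 1) / (cmod c)\<^sup>2) * (cmod c)\<^sup>2 = p - 2 * (p + 1)"
        using cpos by simp
      with expand[of "- (p + 1) / (cmod c)\<^sup>2"] True pq show ?thesis by simp
    next
      case False
      with pq have "0 < q" by simp
      have "0 \<le> p - (cmod c)\<^sup>2 / q"
        using expand[of "- 1 / q"] \<open>0 < q\<close> by (simp add: power2_eq_square field_simps)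
      then show ?thesis using \<open>0 < q\<close> by (simp add: field_simps)
    qed
  qed
  then show ?thesis by (simp add: c_def p_def q_def)
qed

lemma cinner_Cauchy_Schwarz: "cmod (cinner x y) \<le> norm x * norm (y::'a::chilbert_space)"
proof -
  have "(cmod (cinner x y))\<^sup>2 \<le> (norm x * norm y)\<^sup>2"
    by (rule order_trans[OF cinner_Cauchy_Schwarz_form[of "\<lambda>x. x" x y]])
       (simp_all add: cinner_self power_mult_distrib)
  then show ?thesis by (rule power2_le_imp_le) simp
qed

lemma bounded_bilinear_cinner: "bounded_bilinear (cinner :: 'a::chilbert_space \<Rightarrow> 'a \<Rightarrow> complex)"
  by (unfold_locales; (simp add: cinner_add_left cinner_add_right cinner_scaleR_left cinner_scaleR_right)?)
     (auto intro!: exI[of _ 1] simp: cinner_Cauchy_Schwarz)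

interpretation cinner: bounded_bilinear "cinner :: 'a::chilbert_space \<Rightarrow> 'a \<Rightarrow> complex"
  by (rule bounded_bilinear_cinner)

lemma norm_diff_sqr: "(norm (x - y))\<^sup>2 = (norm x)\<^sup>2 + (norm y)\<^sup>2 - 2 * Re (cinner x y)"
  for x y :: "'a::chilbert_space"
proof -
  have "complex_of_real ((norm (x - y))\<^sup>2)
      = complex_of_real ((norm x)\<^sup>2) + complex_of_real ((norm y)\<^sup>2) - (cinner x y + cnj (cinner x y))"
    unfolding cinner_self[symmetric] cinner_commute[of y x, symmetric]
    by (simp add: cinner.diff_left cinner.diff_right)
  then have "complex_of_real ((norm (x - y))\<^sup>2)
      = complex_of_real ((norm x)\<^sup>2 + (norm y)\<^sup>2 - 2 * Re (cinner x y))"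
    by (simp add: complex_add_cnj)
  then show ?thesis by (simp only: of_real_eq_iff)
qed

lemma two_Re_cinner_le: "2 * Re (cinner x y) \<le> (norm x)\<^sup>2 + (norm (y::'a::chilbert_space))\<^sup>2"
  using norm_diff_sqr[of x y] zero_le_power2[of "norm (x - y)"] by linarith

text \<open>By Zorn's lemma there is a maximal orthonormal set; a nonzero vector orthogonal to it
  could be normalised and added. This makes the choice inside \<open>tr\<close> meaningful.\<close>

lemma orthonormal_basis_exists: "\<exists>B::'a::chilbert_space set. orthonormal_basis B"
proof -
  define ONS :: "'a set set" where
    "ONS = {B. \<forall>b\<in>B. \<forall>c\<in>B. cinner b c = (if b = c then 1 else 0)}"
  have "\<Union>C \<in> ONS" if "subset.chain ONS C" for C
    unfolding ONS_def
  proof (clarify)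
    fix b c X Y assume bc: "b \<in> X" "X \<in> C" "c \<in> Y" "Y \<in> C"
    have C: "C \<subseteq> ONS" "X \<subseteq> Y \<or> Y \<subseteq> X"
      using that bc by (auto simp: subset_chain_def)
    then obtain Z where Z: "Z \<in> C" "b \<in> Z" "c \<in> Z"
      using bc by blast
    then have "Z \<in> ONS" using C by blast
    with Z show "cinner b c = (if b = c then 1 else 0)"
      by (simp add: ONS_def)
  qed
  then obtain B where B: "B \<in> ONS" and max: "\<And>X. X \<in> ONS \<Longrightarrow> B \<subseteq> X \<Longrightarrow> X = B"
    using subset_Zorn'[of ONS] by metis
  have "x = 0" if x: "\<forall>b\<in>B. cinner b x = 0" for x
  proof (rule ccontr)
    assume "x \<noteq> 0"
    define y where "y = (1 / norm x) *\<^sub>R x"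
    have y1: "cinner y y = 1" using \<open>x \<noteq> 0\<close> by (simp add: y_def cinner_self)
    have y0: "cinner b y = 0" "cinner y b = 0" if "b \<in> B" for b
      using x that cinner_commute[of x b] by (simp_all add: y_def cinner.scaleR_left cinner.scaleR_right)
    have "insert y B \<in> ONS"
      using B y0 y1 unfolding ONS_def by auto
    then have "y \<in> B" using max by blast
    then show False using y0(1)[of y] y1 by simp
  qed
  with B have "orthonormal_basis B" by (auto simp: orthonormal_basis_def ONS_def)
  then show ?thesis ..
qed

lemma norm_sum_orthonormal:
  fixes B :: "'a::chilbert_space set"
  assumes B: "\<forall>b\<in>B. \<forall>c\<in>B. cinner b c = (if b = c then 1 else 0)" and F: "finite F" "F \<subseteq> B"
  shows "(norm (\<Sum>b\<in>F. a b *\<^sub>C b))\<^sup>2 = (\<Sum>b\<in>F. (cmod (a b))\<^sup>2)"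
proof -
  have cnj_mult_self: "cnj z * z = complex_of_real ((cmod z)\<^sup>2)" for z
    by (metis complex_norm_square mult.commute)
  have "cinner (\<Sum>b\<in>F. a b *\<^sub>C b) (\<Sum>b\<in>F. a b *\<^sub>C b)
      = (\<Sum>b\<in>F. \<Sum>c\<in>F. cnj (a b) * (a c * cinner b c))"
    by (simp add: cinner.sum_left cinner_scaleC_left sum_distrib_left)
       (simp add: cinner.sum_right cinner_scaleC_right sum_distrib_left)
  also have "\<dots> = (\<Sum>b\<in>F. \<Sum>c\<in>F. if b = c then complex_of_real ((cmod (a b))\<^sup>2) else 0)"
    using B F cnj_mult_self by (intro sum.cong refl) (auto simp: subset_iff)
  also have "\<dots> = complex_of_real (\<Sum>b\<in>F. (cmod (a b))\<^sup>2)"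
    using F by simp
  finally show ?thesis by (simp only: cinner_self of_real_eq_iff)
qed

lemma Bessel_inequality:
  fixes B :: "'a::chilbert_space set"
  assumes B: "\<forall>b\<in>B. \<forall>c\<in>B. cinner b c = (if b = c then 1 else 0)" and F: "finite F" "F \<subseteq> B"
  shows "(\<Sum>b\<in>F. (cmod (cinner b x))\<^sup>2) \<le> (norm x)\<^sup>2"
proof -
  have "cinner x (\<Sum>b\<in>F. cinner b x *\<^sub>C b) = complex_of_real (\<Sum>b\<in>F. (cmod (cinner b x))\<^sup>2)"
    by (simp add: cinner.sum_right cinner_scaleC_right complex_mult_cnj cmod_power2
        cinner_commute[of x])
  then have "Re (cinner x (\<Sum>b\<in>F. cinner b x *\<^sub>C b)) = (\<Sum>b\<in>F. (cmod (cinner b x))\<^sup>2)"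
    by simp
  with two_Re_cinner_le[of x "\<Sum>b\<in>F. cinner b x *\<^sub>C b"] norm_sum_orthonormal[OF B F, of "\<lambda>b. cinner b x"]
  show ?thesis by simp
qed

text \<open>The squared distance between nested partial sums is a partial sum of the squared
  coefficients, so the net of partial sums is Cauchy and completeness applies.\<close>

lemma summable_on_orthonormal:
  fixes B :: "'a::chilbert_space set"
  assumes B: "\<forall>b\<in>B. \<forall>c\<in>B. cinner b c = (if b = c then 1 else 0)"
    and a: "(\<lambda>b. (cmod (a b))\<^sup>2) summable_on B"
  shows "(\<lambda>b. a b *\<^sub>C b) summable_on B"
proof -
  define f where "f b = a b *\<^sub>C b" for b
  define n where "n b = (cmod (a b))\<^sup>2" for b
  have "\<exists>P. eventually P (finite_subsets_at_top B) \<and>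
            (\<forall>F F'. P F \<and> P F' \<longrightarrow> dist (sum f F) (sum f F') < e)" if "e > 0" for e
  proof -
    \<comment> \<open>Tolerance \<open>(e/2)\<^sup>2\<close> because the tail bounds a squared norm;
      the extra halving below turns a non-strict approximation into a strict one.\<close>
    obtain F0 where F0: "finite F0" "F0 \<subseteq> B" "dist (sum n F0) (infsum n B) < (e/2)\<^sup>2"
    proof -
      have "0 < (e/2)\<^sup>2 / 2" using \<open>e > 0\<close> by simp
      moreover have "n summable_on B" using a by (simp add: n_def[abs_def])
      ultimately obtain F where "finite F" "F \<subseteq> B" "dist (sum n F) (infsum n B) \<le> (e/2)\<^sup>2 / 2"
        using infsum_finite_approximation[of n B "(e/2)\<^sup>2 / 2"] by blast
      moreover have "(e/2)\<^sup>2 / 2 < (e/2)\<^sup>2" using \<open>e > 0\<close> by simp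
      ultimately show ?thesis using that by (meson order_le_less_trans)
    qed
    define P where "P F \<longleftrightarrow> finite F \<and> F0 \<subseteq> F \<and> F \<subseteq> B" for F
    have ev: "eventually P (finite_subsets_at_top B)"
      unfolding eventually_finite_subsets_at_top P_def using F0 by blast
    have near: "dist (sum f F) (sum f F0) < e/2" if "P F" for F
    proof -
      have F: "finite F" "F0 \<subseteq> F" "F \<subseteq> B" using that by (auto simp: P_def)
      have "(dist (sum f F) (sum f F0))\<^sup>2 = (norm (sum f (F - F0)))\<^sup>2"
        using F by (simp add: dist_norm sum_diff)
      also have "\<dots> = sum n (F - F0)"
        unfolding f_def n_def using F by (intro norm_sum_orthonormal[OF B]) auto
      also have "\<dots> = sum n F - sum n F0" using F by (simp add: sum_diff)
      also have "\<dots> \<le> infsum n B - sum n F0"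
        using finite_sum_le_infsum[of n B F] a F by (simp add: n_def[abs_def])
      also have "\<dots> < (e/2)\<^sup>2" using F0(3) by (simp add: dist_real_def)
      finally show ?thesis by (rule power2_less_imp_less) (use \<open>e > 0\<close> in simp)
    qed
    have "dist (sum f F) (sum f F') < e" if "P F" "P F'" for F F'
      using near[OF that(1)] near[OF that(2)] dist_triangle2[of "sum f F" "sum f F'" "sum f F0"]
      by linarith
    with ev show ?thesis by blast
  qed
  then have "cauchy_filter (filtermap (sum f) (finite_subsets_at_top B))"
    by (simp add: cauchy_filter_metric_filtermap)
  moreover have "complete (UNIV :: 'a set)"
    by (meson Cauchy_convergent UNIV_I complete_def convergent_def)
  ultimately obtain L where "(sum f \<longlongrightarrow> L) (finite_subsets_at_top B)"
    using complete_uniform[where S = "UNIV :: 'a set"] by (force simp add: filterlim_def)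
  then show ?thesis
    unfolding f_def[abs_def] summable_on_def has_sum_def by blast
qed

lemma orthonormal_basis_expansion:
  fixes B :: "'a::chilbert_space set"
  assumes B: "orthonormal_basis B"
  shows "((\<lambda>b. cinner b x *\<^sub>C b) has_sum x) B"
proof -
  from B have on: "\<forall>b\<in>B. \<forall>c\<in>B. cinner b c = (if b = c then 1 else 0)"
    by (simp add: orthonormal_basis_def)
  have "(\<lambda>b. (cmod (cinner b x))\<^sup>2) summable_on B"
    using Bessel_inequality[OF on, of _ x]
    by (intro nonneg_bdd_above_summable_on) (auto intro!: bdd_aboveI[of _ "(norm x)\<^sup>2"])
  then have "(\<lambda>b. cinner b x *\<^sub>C b) summable_on B"
    by (rule summable_on_orthonormal[OF on])
  then obtain y where y: "((\<lambda>b. cinner b x *\<^sub>C b) has_sum y) B"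
    by (auto simp: summable_on_def)
  \<comment> \<open>The series converges to some \<open>y\<close> with the same coefficients as
    \<open>x\<close>; a basis annihilates only 0, so \<open>x = y\<close>.\<close>
  have "cinner b (x - y) = 0" if "b \<in> B" for b
  proof -
    have "((\<lambda>c. cinner b (cinner c x *\<^sub>C c)) has_sum cinner b y) B"
      using has_sum_bounded_linear[OF cinner.bounded_linear_right y] by (simp add: o_def)
    moreover have "((\<lambda>c. cinner b (cinner c x *\<^sub>C c)) has_sum cinner b x) B"
      using on that by (intro has_sum_finite_neutralI[of "{b}"]) (auto simp: cinner_scaleC_right)
    ultimately show ?thesis
      using has_sum_unique by (fastforce simp: cinner.diff_right)
  qed
  then have "x - y = 0" using B unfolding orthonormal_basis_def by blast
  with y show ?thesis by simp
qed

lemma Parseval_identity: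
  fixes B :: "'a::chilbert_space set"
  assumes "orthonormal_basis B"
  shows "((\<lambda>b. cinner x b * cinner b y) has_sum cinner x y) B"
  using has_sum_bounded_linear[OF cinner.bounded_linear_right[of x] orthonormal_basis_expansion[OF assms, of y]]
  by (simp add: cinner_scaleC_right o_def mult.commute)

lemma Parseval_norm:
  fixes B :: "'a::chilbert_space set"
  assumes "orthonormal_basis B"
  shows "((\<lambda>b. (cmod (cinner b x))\<^sup>2) has_sum (norm x)\<^sup>2) B"
proof -
  have "Re (cinner x b * cinner b x) = (cmod (cinner b x))\<^sup>2" for b
    by (simp add: cinner_commute[of x b] cmod_power2) (simp add: power2_eq_square)
  then show ?thesis
    using has_sum_Re[OF Parseval_identity[OF assms, of x x]] by (simp add: cinner_self)
qed

subsection \<open>Traces and Hilbert-Schmidt sums\<close>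

lemma has_sum_finite_sum:
  fixes f :: "'i \<Rightarrow> 'b \<Rightarrow> 'c::topological_comm_monoid_add"
  assumes "\<And>i. i \<in> I \<Longrightarrow> (f i has_sum a i) A"
  shows "((\<lambda>x. \<Sum>i\<in>I. f i x) has_sum (\<Sum>i\<in>I. a i)) A"
  using assms by (induction I rule: infinite_finite_induct) (auto intro: has_sum_add)

lemma summable_on_Hilbert_Schmidt:
  fixes B :: "'a::chilbert_space set" and X :: "'a \<Rightarrow> 'a"
  assumes B: "orthonormal_basis B" and X: "(\<lambda>b. (norm (X b))\<^sup>2) summable_on B"
  shows "(\<lambda>(b, c). (cmod (cinner c (X b)))\<^sup>2) summable_on B \<times> B"
proof (rule summable_on_SigmaI)
  fix b show "((\<lambda>c. case (b, c) of (b, c) \<Rightarrow> (cmod (cinner c (X b)))\<^sup>2) has_sum (norm (X b))\<^sup>2) B"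
    using Parseval_norm[OF B, of "X b"] by simp
qed (use X in auto)

text \<open>The matrix of the adjoint is the conjugate transpose, so both square sums run over the
  same nonnegative double family. Plain maps are allowed because the square root obtained later
  comes without a linearity or boundedness statement.\<close>

lemma summable_on_Hilbert_Schmidt_adjoint:
  fixes B :: "'a::chilbert_space set" and X :: "'a \<Rightarrow> 'a"
  assumes B: "orthonormal_basis B" and X: "(\<lambda>b. (norm (X b))\<^sup>2) summable_on B"
    and adj: "\<And>x y. cinner (X x) y = cinner x (X' y)"
  shows "(\<lambda>b. (norm (X' b))\<^sup>2) summable_on B"
proof -
  have "cmod (cinner c (X b)) = cmod (cinner b (X' c))" for b c
    by (metis adj cinner_commute complex_mod_cnj)
  then have "(\<lambda>(b, c). (cmod (cinner b (X' c)))\<^sup>2) summable_on B \<times> B"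
    using summable_on_Hilbert_Schmidt[OF B X] by simp
  then have "(\<lambda>(c, b). (cmod (cinner b (X' c)))\<^sup>2) summable_on B \<times> B"
    by (subst summable_on_swap) (simp add: case_prod_unfold o_def)
  then have "(\<lambda>c. infsum (\<lambda>b. (cmod (cinner b (X' c)))\<^sup>2) B) summable_on B"
    by (rule summable_on_Sigma_banach)
  moreover have "infsum (\<lambda>b. (cmod (cinner b (X' c)))\<^sup>2) B = (norm (X' c))\<^sup>2" for c
    using Parseval_norm[OF B, of "X' c"] by (rule infsumI)
  ultimately show ?thesis by simp
qed

text \<open>Parseval expands each inner product into a row of one double family, and the adjoint
  relations turn its columns into the other side. AM-GM dominates the family by squared matrix
  entries, which justifies the exchange of sums.\<close>

lemma infsum_cinner_adjoint:
  fixes B :: "'a::chilbert_space set" and X Y :: "'a \<Rightarrow> 'a"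
  assumes B: "orthonormal_basis B"
    and X: "(\<lambda>b. (norm (X b))\<^sup>2) summable_on B" and Y: "(\<lambda>b. (norm (Y b))\<^sup>2) summable_on B"
    and adjX: "\<And>x y. cinner (X x) y = cinner x (X' y)"
    and adjY: "\<And>x y. cinner (Y x) y = cinner x (Y' y)"
  shows "(\<Sum>\<^sub>\<infinity>b\<in>B. cinner (X b) (Y b)) = (\<Sum>\<^sub>\<infinity>c\<in>B. cinner (Y' c) (X' c))"
proof -
  define f where "f b c = cinner (X b) c * cinner c (Y b)" for b c
  have f_swap: "f b c = cinner (Y' c) b * cinner b (X' c)" for b c
    unfolding f_def using adjX[of b c] adjY[of b c] cinner_commute[of c "Y b"] cinner_commute[of "Y' c" b]
    by simp
  have bound: "cmod (f b c) \<le> (cmod (cinner c (X b)))\<^sup>2 + (cmod (cinner c (Y b)))\<^sup>2" for b c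
  proof -
    have "cmod (f b c) = cmod (cinner c (X b)) * cmod (cinner c (Y b))"
      unfolding f_def norm_mult by (metis cinner_commute complex_mod_cnj)
    then show ?thesis
      using sum_squares_bound[of "cmod (cinner c (X b))" "cmod (cinner c (Y b))"]
        zero_le_power2[of "cmod (cinner c (X b))"] zero_le_power2[of "cmod (cinner c (Y b))"]
      by linarith
  qed
  have "(\<lambda>(b, c). (cmod (cinner c (X b)))\<^sup>2 + (cmod (cinner c (Y b)))\<^sup>2) summable_on B \<times> B"
    using summable_on_add[OF summable_on_Hilbert_Schmidt[OF B X] summable_on_Hilbert_Schmidt[OF B Y]]
    by (simp add: case_prod_unfold)
  then have "(\<lambda>p. norm (case p of (b, c) \<Rightarrow> f b c)) summable_on B \<times> B"
    by (rule summable_on_comparison_test) (auto simp: bound)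
  then have "(\<lambda>(b, c). f b c) summable_on B \<times> B"
    by (rule abs_summable_summable)
  then have "(\<Sum>\<^sub>\<infinity>b\<in>B. \<Sum>\<^sub>\<infinity>c\<in>B. f b c) = (\<Sum>\<^sub>\<infinity>c\<in>B. \<Sum>\<^sub>\<infinity>b\<in>B. f b c)"
    by (rule infsum_swap_banach)
  moreover have "(\<Sum>\<^sub>\<infinity>c\<in>B. f b c) = cinner (X b) (Y b)" for b
    unfolding f_def by (rule infsumI[OF Parseval_identity[OF B]])
  moreover have "(\<Sum>\<^sub>\<infinity>b\<in>B. f b c) = cinner (Y' c) (X' c)" for c
    unfolding f_swap by (rule infsumI[OF Parseval_identity[OF B]])
  ultimately show ?thesis by simp
qed

lemma summable_on_norm_blinfun_sqr:
  fixes A :: "'a::real_normed_vector \<Rightarrow>\<^sub>L 'b::real_normed_vector"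
  assumes "(\<lambda>i. (norm (\<psi> i))\<^sup>2) summable_on I"
  shows "(\<lambda>i. (norm (A (\<psi> i)))\<^sup>2) summable_on I"
proof -
  have "(\<lambda>i. (norm A)\<^sup>2 * (norm (\<psi> i))\<^sup>2) summable_on I"
    using assms by (rule summable_on_cmult_right)
  moreover have "(norm (A (\<psi> i)))\<^sup>2 \<le> (norm A)\<^sup>2 * (norm (\<psi> i))\<^sup>2" for i
    unfolding power_mult_distrib[symmetric] by (simp add: norm_blinfun power_mono)
  ultimately show ?thesis
    by (rule summable_on_comparison_test) simp
qed

text \<open>
  Both sides are the Hilbert-Schmidt inner product of \<open>R A\<^sup>*\<close> and \<open>R C\<close>, computed once along these
  operators and once along their adjoints.
\<close>

lemma trace_sandwich:
  fixes \<sigma> :: "'a::chilbert_space \<Rightarrow>\<^sub>L 'a" and A A' C C' :: "'a \<Rightarrow>\<^sub>L 'a"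
  defines "B \<equiv> SOME B :: 'a set. orthonormal_basis B"
  assumes sq: "\<And>x. R (R x) = \<sigma> x"
    and sa: "\<And>x y. cinner (R x) y = cinner x (R y)"
    and R: "(\<lambda>b. (norm (R b))\<^sup>2) summable_on B"
    and adjA: "\<And>x y. cinner (A x) y = cinner x (A' y)"
    and adjC: "\<And>x y. cinner (C x) y = cinner x (C' y)"
  shows "((\<lambda>b. cinner (C' (R b)) (A (R b))) has_sum tr (A o\<^sub>L \<sigma> o\<^sub>L C)) B"
proof -
  have B: "orthonormal_basis B"
    unfolding B_def by (rule someI_ex[OF orthonormal_basis_exists])
  have AR: "(\<lambda>b. (norm (A (R b)))\<^sup>2) summable_on B" and CR: "(\<lambda>b. (norm (C' (R b)))\<^sup>2) summable_on B"
    using R by (rule summable_on_norm_blinfun_sqr)+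
  have adjA': "cinner (A' x) y = cinner x (A y)" and adjC': "cinner (C' x) y = cinner x (C y)" for x y
    using adjA[of y x] adjC[of y x] cinner_commute by metis+
  \<comment> \<open>\<open>R\<close> after \<open>A'\<close> is adjoint to \<open>A\<close> after
    \<open>R\<close>, whose square sum is already known to converge; likewise for \<open>C\<close>
    below.\<close>
  have RA: "(\<lambda>b. (norm (R (A' b)))\<^sup>2) summable_on B"
    by (rule summable_on_Hilbert_Schmidt_adjoint[OF B AR]) (simp add: adjA sa)
  have RC: "(\<lambda>b. (norm (R (C b)))\<^sup>2) summable_on B"
    by (rule summable_on_Hilbert_Schmidt_adjoint[OF B CR]) (simp add: adjC' sa)
  have "tr (A o\<^sub>L \<sigma> o\<^sub>L C) = (\<Sum>\<^sub>\<infinity>b\<in>B. cinner (R (A' b)) (R (C b)))"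
    unfolding tr_def B_def[symmetric] by (simp add: sa adjA' flip: sq)
  also have "\<dots> = (\<Sum>\<^sub>\<infinity>b\<in>B. cinner (C' (R b)) (A (R b)))"
    by (rule infsum_cinner_adjoint[OF B RA RC]) (simp_all add: sa adjA' adjC)
  finally have eq: "tr (A o\<^sub>L \<sigma> o\<^sub>L C) = (\<Sum>\<^sub>\<infinity>b\<in>B. cinner (C' (R b)) (A (R b)))" .
  \<comment> \<open>An equation between infinite sums does not give convergence, since a divergent
    sum has value 0; it is shown separately.\<close>
  have "(\<lambda>b. cmod (cinner (C' (R b)) (A (R b)))) summable_on B"
  proof (rule summable_on_comparison_test[OF summable_on_add[OF CR AR]])
    fix b
    have "2 * norm (C' (R b)) * norm (A (R b)) \<le> (norm (C' (R b)))\<^sup>2 + (norm (A (R b)))\<^sup>2"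
      by (rule sum_squares_bound)
    moreover have "0 \<le> norm (C' (R b)) * norm (A (R b))" by simp
    ultimately show "cmod (cinner (C' (R b)) (A (R b))) \<le> (norm (C' (R b)))\<^sup>2 + (norm (A (R b)))\<^sup>2"
      using cinner_Cauchy_Schwarz[of "C' (R b)" "A (R b)"] by linarith
  qed simp
  then show ?thesis
    unfolding eq by (rule has_sum_infsum[OF abs_summable_summable])
qed

subsection \<open>Square roots of positive operators\<close>

text \<open>Taylor coefficients of \<open>\<surd>(1 - x)\<close> at \<open>0\<close>; the power series converges absolutely up to \<open>|x| = 1\<close>.\<close>

definition sqrt_coeff :: "nat \<Rightarrow> real"
  where "sqrt_coeff n = pochhammer (- 1/2) n / fact n"

lemma sqrt_coeff_0: "sqrt_coeff 0 = 1"
  by (simp add: sqrt_coeff_def)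

text \<open>Vandermonde's identity: the Cauchy product of the series of (1 - x)^(-a) and (1 -
  x)^(-b).\<close>

lemma pochhammer_convolution:
  fixes a b :: real
  shows "(\<Sum>i\<le>n. (pochhammer a i / fact i) * (pochhammer b (n - i) / fact (n - i)))
    = pochhammer (a + b) n / fact n"
  unfolding pochhammer_binomial_sum sum_divide_distrib
  by (intro sum.cong refl) (simp add: binomial_fact)

lemma sqrt_coeff_convolution:
  "(\<Sum>i\<le>n. sqrt_coeff i * sqrt_coeff (n - i)) = (if n = 0 then 1 else if n = 1 then - 1 else 0)"
proof -
  have "(\<Sum>i\<le>n. sqrt_coeff i * sqrt_coeff (n - i)) = pochhammer (- 1) n / fact n"
    using pochhammer_convolution[of "- 1/2" "- 1/2" n] by (simp add: sqrt_coeff_def)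
  also have "\<dots> = (if n = 0 then 1 else if n = 1 then - 1 else 0)"
  proof -
    consider "n = 0" | "n = 1" | m where "n = Suc (Suc m)"
      by (metis One_nat_def not0_implies_Suc)
    then show ?thesis by cases (simp_all add: pochhammer_rec)
  qed
  finally show ?thesis .
qed

lemma sqrt_coeff_Suc_nonpos: "sqrt_coeff (Suc n) \<le> 0"
proof -
  have "0 \<le> pochhammer (1/2 :: real) n" by (simp add: pochhammer_nonneg)
  then show ?thesis by (simp add: sqrt_coeff_def pochhammer_rec)
qed

text \<open>Only the zeroth coefficient is positive, so the absolute sum is 2 minus the plain sum.
  The plain sum is a coefficient of (1 - x)^(1/2) / (1 - x) = (1 - x)^(-1/2), hence
  nonnegative.\<close>

lemma sqrt_coeff_abs_sum_le: "(\<Sum>i\<le>n. \<bar>sqrt_coeff i\<bar>) \<le> 2"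
proof -
  have "\<bar>sqrt_coeff i\<bar> = (if i = 0 then 2 else 0) - sqrt_coeff i" for i
    using sqrt_coeff_Suc_nonpos by (cases i) (auto simp: sqrt_coeff_0)
  then have "(\<Sum>i\<le>n. \<bar>sqrt_coeff i\<bar>) = 2 - (\<Sum>i\<le>n. sqrt_coeff i)"
    by (simp add: sum_subtractf)
  moreover have "(\<Sum>i\<le>n. sqrt_coeff i) = pochhammer (1/2) n / fact n"
    using pochhammer_convolution[of "- 1/2" 1 n] by (simp add: sqrt_coeff_def flip: pochhammer_fact)
  moreover have "0 \<le> pochhammer (1/2 :: real) n" by (simp add: pochhammer_nonneg)
  ultimately show ?thesis by simp
qed

lemma sqrt_coeff_abs_summable: "(\<lambda>n. \<bar>sqrt_coeff n\<bar>) summable_on UNIV"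
proof (rule nonneg_bdd_above_summable_on)
  have "(\<Sum>i\<in>F. \<bar>sqrt_coeff i\<bar>) \<le> 2" if "finite F" for F
  proof -
    obtain n where "F \<subseteq> {..n}" using \<open>finite F\<close> finite_nat_iff_bounded_le[of F] by blast
    then have "(\<Sum>i\<in>F. \<bar>sqrt_coeff i\<bar>) \<le> (\<Sum>i\<le>n. \<bar>sqrt_coeff i\<bar>)"
      by (intro sum_mono2) auto
    with sqrt_coeff_abs_sum_le[of n] show ?thesis by linarith
  qed
  then show "bdd_above (sum (\<lambda>n. \<bar>sqrt_coeff n\<bar>) ` {F. F \<subseteq> UNIV \<and> finite F})"
    by (auto intro!: bdd_aboveI[of _ 2])
qed simp

context
  fixes K :: "'a::chilbert_space \<Rightarrow>\<^sub>L 'a"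
  assumes contraction: "\<And>x. norm (K x) \<le> norm x"
    and self_adj: "\<And>x y. cinner (K x) y = cinner x (K y)"
begin

text \<open>This is the operator sqrt(I - K), with its power series summed at each vector.\<close>

definition sqrt_series :: "'a \<Rightarrow> 'a"
  where "sqrt_series x = (\<Sum>\<^sub>\<infinity>n. sqrt_coeff n *\<^sub>R (blinfun_apply K ^^ n) x)"

lemma norm_funpow_le: "norm ((blinfun_apply K ^^ n) x) \<le> norm x"
  by (induction n) (auto intro: order_trans[OF contraction])

lemma cinner_funpow: "cinner ((blinfun_apply K ^^ n) x) y = cinner x ((blinfun_apply K ^^ n) y)"
  by (induction n arbitrary: x y) (simp_all add: self_adj funpow_swap1)

lemma sqrt_series_has_sum:
  "((\<lambda>n. sqrt_coeff n *\<^sub>R (blinfun_apply K ^^ n) x) has_sum sqrt_series x) UNIV"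
proof -
  have "(\<lambda>n. \<bar>sqrt_coeff n\<bar> * norm x) summable_on UNIV"
    using sqrt_coeff_abs_summable by (rule summable_on_cmult_left)
  then have "(\<lambda>n. norm (sqrt_coeff n *\<^sub>R (blinfun_apply K ^^ n) x)) summable_on UNIV"
    by (rule summable_on_comparison_test) (simp_all add: mult_left_mono norm_funpow_le)
  then show ?thesis
    unfolding sqrt_series_def by (rule has_sum_infsum[OF abs_summable_summable])
qed

lemma sqrt_series_self_adjoint: "cinner (sqrt_series x) y = cinner x (sqrt_series y)"
proof -
  have "((\<lambda>n. sqrt_coeff n *\<^sub>R cinner x ((blinfun_apply K ^^ n) y)) has_sum cinner (sqrt_series x) y) UNIV"
    using has_sum_bounded_linear[OF cinner.bounded_linear_left[of y] sqrt_series_has_sum[of x]]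
    by (simp add: cinner.scaleR_left cinner_funpow o_def)
  moreover have "((\<lambda>n. sqrt_coeff n *\<^sub>R cinner x ((blinfun_apply K ^^ n) y)) has_sum cinner x (sqrt_series y)) UNIV"
    using has_sum_bounded_linear[OF cinner.bounded_linear_right[of x] sqrt_series_has_sum[of y]]
    by (simp add: cinner.scaleR_right o_def)
  ultimately show ?thesis by (rule has_sum_unique)
qed

lemma sqrt_series_scaleR: "sqrt_series (r *\<^sub>R x) = r *\<^sub>R sqrt_series x"
proof -
  have "(blinfun_apply K ^^ n) (r *\<^sub>R x) = r *\<^sub>R (blinfun_apply K ^^ n) x" for n
    by (induction n) (simp_all add: blinfun.scaleR_right)
  then have "((\<lambda>n. sqrt_coeff n *\<^sub>R (blinfun_apply K ^^ n) (r *\<^sub>R x)) has_sum r *\<^sub>R sqrt_series x) UNIV"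
    using has_sum_bounded_linear[OF bounded_linear_scaleR_right[of r] sqrt_series_has_sum[of x]]
    by (simp add: o_def mult.commute)
  then show ?thesis
    by (rule has_sum_unique[OF sqrt_series_has_sum])
qed

lemma funpow_sqrt_series_has_sum:
  "((\<lambda>j. sqrt_coeff j *\<^sub>R (blinfun_apply K ^^ (i + j)) x) has_sum (blinfun_apply K ^^ i) (sqrt_series x)) UNIV"
proof (induction i)
  case 0
  show ?case using sqrt_series_has_sum by simp
next
  case (Suc i)
  show ?case
    using has_sum_bounded_linear[OF blinfun.bounded_linear_right[of K] Suc.IH]
    by (simp add: o_def blinfun.scaleR_right)
qed

text \<open>The absolutely summable double family \<open>f\<close> is summed in two ways: by rows it
  gives the iterated series, by diagonals the Cauchy product, whose coefficients are those of 1 -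
  x.\<close>

lemma sqrt_series_twice: "sqrt_series (sqrt_series x) = x - K x"
proof -
  define f where "f = (\<lambda>(i, j). (sqrt_coeff i * sqrt_coeff j) *\<^sub>R (blinfun_apply K ^^ (i + j)) x)"
  have "(\<lambda>(i, j). \<bar>sqrt_coeff i\<bar> * \<bar>sqrt_coeff j\<bar> * norm x) summable_on UNIV \<times> UNIV"
  proof (rule summable_on_SigmaI)
    define s where "s = (\<Sum>\<^sub>\<infinity>j. \<bar>sqrt_coeff j\<bar>)"
    have s: "((\<lambda>j. \<bar>sqrt_coeff j\<bar>) has_sum s) UNIV"
      unfolding s_def by (rule has_sum_infsum[OF sqrt_coeff_abs_summable])
    show "((\<lambda>j. case (i, j) of (i, j) \<Rightarrow> \<bar>sqrt_coeff i\<bar> * \<bar>sqrt_coeff j\<bar> * norm x)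
        has_sum \<bar>sqrt_coeff i\<bar> * s * norm x) UNIV" for i
      using has_sum_cmult_left[OF has_sum_cmult_right[OF s]] by simp
    show "(\<lambda>i. \<bar>sqrt_coeff i\<bar> * s * norm x) summable_on UNIV"
      by (intro summable_on_cmult_left sqrt_coeff_abs_summable)
  qed auto
  then have "(\<lambda>p. norm (f p)) summable_on UNIV \<times> UNIV"
    by (rule summable_on_comparison_test)
       (auto simp: f_def abs_mult intro!: mult_left_mono norm_funpow_le)
  then obtain s where s: "(f has_sum s) (UNIV \<times> UNIV)"
    using abs_summable_summable summable_on_def by blast
  have "((\<lambda>j. f (i, j)) has_sum sqrt_coeff i *\<^sub>R (blinfun_apply K ^^ i) (sqrt_series x)) UNIV" for i
    using has_sum_bounded_linear[OF bounded_linear_scaleR_right[of "sqrt_coeff i"] funpow_sqrt_series_has_sum[of i x]]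
    by (simp add: o_def f_def)
  then have "((\<lambda>i. sqrt_coeff i *\<^sub>R (blinfun_apply K ^^ i) (sqrt_series x)) has_sum s) UNIV"
    by (rule has_sum_SigmaD[OF s])
  then have 1: "sqrt_series (sqrt_series x) = s"
    by (rule has_sum_unique[OF sqrt_series_has_sum])
  have "bij_betw (\<lambda>(n, i). (i, n - i)) (Sigma UNIV (\<lambda>n::nat. {..n})) (UNIV \<times> UNIV)"
    by (rule bij_betwI[of _ _ _ "\<lambda>(i, j). (i + j, i)"]) auto
  then have "((\<lambda>p. f ((\<lambda>(n, i). (i, n - i)) p)) has_sum s) (Sigma UNIV (\<lambda>n. {..n}))"
    using s by (simp only: has_sum_reindex_bij_betw)
  then have "((\<lambda>n. \<Sum>i\<le>n. f (i, n - i)) has_sum s) UNIV"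
    by (rule has_sum_SigmaD) (simp add: has_sum_finiteI)
  moreover have "(\<Sum>i\<le>n. f (i, n - i)) = (\<Sum>i\<le>n. sqrt_coeff i * sqrt_coeff (n - i)) *\<^sub>R (blinfun_apply K ^^ n) x" for n
    by (simp add: f_def scaleR_sum_left)
  ultimately have "((\<lambda>n. (if n = 0 then 1 else if n = 1 then - 1 else 0) *\<^sub>R (blinfun_apply K ^^ n) x) has_sum s) UNIV"
    by (simp only: sqrt_coeff_convolution)
  moreover have "((\<lambda>n. (if n = 0 then 1 else if n = 1 then - 1 else 0) *\<^sub>R (blinfun_apply K ^^ n) x) has_sum x - K x) UNIV"
    by (rule has_sum_finite_neutralI[of "{0, 1}"]) auto
  ultimately have "s = x - K x" by (rule has_sum_unique)
  with 1 show ?thesis by simp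
qed

end

text \<open>Scaling by \<open>M = norm A\<close> gives \<open>K = I - A / M\<close> with 0 \<le> K
  \<le> I, so \<open>A = M (I - K)\<close> and sqrt(M) times the series for \<open>K\<close> is a
  root. The case \<open>A = 0\<close> is split off because of the division by
  \<open>M\<close>.\<close>

lemma positive_semidefinite_sqrt:
  fixes A :: "'a::chilbert_space \<Rightarrow>\<^sub>L 'a"
  assumes A: "positive_semidefinite A"
  obtains R where "\<And>x. R (R x) = A x" "\<And>x y. cinner (R x) y = cinner x (R y)"
proof (cases "A = 0")
  case True
  show ?thesis by (rule that[of "\<lambda>_. 0"]) (simp_all add: True cinner.zero_left cinner.zero_right)
next
  case False
  have lin: "A (a *\<^sub>C x) = a *\<^sub>C A x" and sa: "cinner (A x) y = cinner x (A y)"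
    and pos: "0 \<le> Re (cinner x (A x))" for a x y
    using A by (auto simp: positive_semidefinite_def complex_linear_def self_adjoint_def)
  define M where "M = norm A"
  have "0 < M" using False by (simp add: M_def)
  define K where "K = id_blinfun - (1 / M) *\<^sub>R A"
  have K: "K x = x - (1 / M) *\<^sub>R A x" for x
    by (simp add: K_def blinfun.diff_left blinfun.scaleR_left)
  have K_sa: "cinner (K x) y = cinner x (K y)" for x y
    by (simp add: K cinner.diff_left cinner.diff_right cinner.scaleR_left cinner.scaleR_right sa)
  have K_scale: "K (a *\<^sub>C x) = a *\<^sub>C K x" for a x
  proof -
    have "a *\<^sub>C K x + a *\<^sub>C ((1 / M) *\<^sub>R A x) = a *\<^sub>C x"
      by (simp add: K flip: scaleC_add_right)
    moreover have "a *\<^sub>C ((1 / M) *\<^sub>R A x) = (1 / M) *\<^sub>R (a *\<^sub>C A x)"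
      by (simp add: scaleR_scaleC[where 'a = 'a] scaleC_scaleC mult.commute)
    ultimately show ?thesis by (simp add: K[of "a *\<^sub>C x"] lin algebra_simps)
  qed
  have ReK: "Re (cinner x (K x)) = (norm x)\<^sup>2 - Re (cinner x (A x)) / M" for x
    by (simp add: K cinner.diff_right cinner.scaleR_right cinner_self)
  have K_le: "Re (cinner x (K x)) \<le> (norm x)\<^sup>2" for x
    using pos[of x] \<open>0 < M\<close> by (simp add: ReK)
  have K_pos: "0 \<le> Re (cinner x (K x))" for x
  proof -
    have "Re (cinner x (A x)) \<le> norm x * norm (A x)"
      using complex_Re_le_cmod[of "cinner x (A x)"] cinner_Cauchy_Schwarz[of x "A x"] by linarith
    also have "\<dots> \<le> norm x * (M * norm x)"
      unfolding M_def by (intro mult_left_mono norm_blinfun) simp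
    finally show ?thesis
      using \<open>0 < M\<close> by (simp add: ReK power2_eq_square field_simps)
  qed
  have contr: "norm (K x) \<le> norm x" for x
  proof (cases "K x = 0")
    case False
    \<comment> \<open>Cauchy-Schwarz for the form of \<open>K\<close> at \<open>K x\<close> and
      \<open>x\<close> bounds the fourth power of \<open>norm (K x)\<close> by the product of the
      squared norms of \<open>K x\<close> and \<open>x\<close>; cancelling gives the
      contraction.\<close>
    have "(cmod (cinner (K x) (K x)))\<^sup>2 \<le> Re (cinner (K x) (K (K x))) * Re (cinner x (K x))"
      by (rule cinner_Cauchy_Schwarz_form) (simp_all add: K_sa K_scale K_pos blinfun.add_right)
    also have "\<dots> \<le> (norm (K x))\<^sup>2 * (norm x)\<^sup>2"
      by (intro mult_mono K_le K_pos) simp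
    finally have "(norm (K x))\<^sup>2 * (norm (K x))\<^sup>2 \<le> (norm (K x))\<^sup>2 * (norm x)\<^sup>2"
      by (simp add: cinner_self norm_mult power2_eq_square)
    then have "(norm (K x))\<^sup>2 \<le> (norm x)\<^sup>2"
      by (rule mult_left_le_imp_le) (use False in simp)
    then show ?thesis by (rule power2_le_imp_le) simp
  qed simp
  define R where "R x = sqrt M *\<^sub>R sqrt_series K x" for x
  show ?thesis
  proof (rule that[of R])
    show "R (R x) = A x" for x
      using \<open>0 < M\<close> by (simp add: R_def sqrt_series_scaleR[OF contr K_sa] sqrt_series_twice[OF contr K_sa] K)
    show "cinner (R x) y = cinner x (R y)" for x y
      by (simp add: R_def cinner.scaleR_left cinner.scaleR_right sqrt_series_self_adjoint[OF contr K_sa])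
  qed
qed

subsection \<open>Products of projectors\<close>

lemma projector_adjoint: "projector P \<Longrightarrow> cinner (P x) y = cinner x (P y)"
  by (simp add: projector_def self_adjoint_def)

lemma projector_idem: "projector P \<Longrightarrow> P (P x) = P x"
  unfolding projector_def by (metis blinfun_apply_blinfun_compose)

lemma cinner_projector: "projector P \<Longrightarrow> cinner x (P x) = complex_of_real ((norm (P x))\<^sup>2)"
  by (metis cinner_self projector_adjoint projector_idem)

lemma norm_projector_compl: "projector P \<Longrightarrow> (norm (x - P x))\<^sup>2 = (norm x)\<^sup>2 - (norm (P x))\<^sup>2"
  by (simp add: norm_diff_sqr cinner_projector)

lemma norm_projector_le: "projector P \<Longrightarrow> (norm (P x))\<^sup>2 \<le> (norm x)\<^sup>2"
  using norm_projector_compl[of P x] zero_le_power2[of "norm (x - P x)"] by linarith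

text \<open>\<open>x - P x\<close> is orthogonal to the range of \<open>P\<close>, so
  \<open>y\<close> may be replaced by \<open>y - P y\<close> before AM-GM; this replacement produces
  the term in \<open>P y\<close>.\<close>

lemma two_Re_cinner_projector_compl_le:
  assumes P: "projector P"
  shows "2 * Re (cinner (x - P x) y)
    \<le> ((norm x)\<^sup>2 - (norm (P x))\<^sup>2) + ((norm y)\<^sup>2 - (norm (P y))\<^sup>2)"
proof -
  have "cinner (x - P x) (P y) = 0"
    using P by (simp add: cinner.diff_left projector_adjoint projector_idem)
  then have "cinner (x - P x) y = cinner (x - P x) (y - P y)"
    by (simp add: cinner.diff_right)
  then show ?thesis
    using two_Re_cinner_le[of "x - P x" "y - P y"] P by (simp add: norm_projector_compl)
qed

text \<open>Keeping the weight \<open>s\<close> free makes the bound linear in the squared norms, so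
  one \<open>s\<close> can serve every ensemble vector and be optimised after summation.\<close>

lemma norm_projector_triple_ge:
  assumes P: "projector P1" "projector P2" "projector P3" and "0 \<le> s"
  shows "s * ((norm (P1 v))\<^sup>2 + (norm (P2 v))\<^sup>2 + (norm (P3 v))\<^sup>2 - 2 * (norm v)\<^sup>2) - s\<^sup>2 * (norm v)\<^sup>2
    \<le> (norm (P3 (P2 (P1 v))))\<^sup>2"
proof -
  define a b x where "a = P1 v" and "b = P2 a" and "x = P3 b"
  have "cinner v a = complex_of_real ((norm a)\<^sup>2)"
    unfolding a_def by (rule cinner_projector[OF P(1)])
  then have "2 * (norm a)\<^sup>2 = 2 * Re (cinner a v)"
    by (metis Re_complex_of_real cinner_commute complex_cnj_complex_of_real)
  also have "\<dots> = 2 * Re (cinner x v) + 2 * Re (cinner (a - P2 a) v) + 2 * Re (cinner (b - P3 b) v)"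
    by (simp add: b_def x_def cinner.diff_left)
  also have "\<dots> \<le> 2 * Re (cinner x v) + ((norm a)\<^sup>2 - (norm b)\<^sup>2 + ((norm v)\<^sup>2 - (norm (P2 v))\<^sup>2))
      + ((norm b)\<^sup>2 - (norm x)\<^sup>2 + ((norm v)\<^sup>2 - (norm (P3 v))\<^sup>2))"
    using two_Re_cinner_projector_compl_le[OF P(2), of a v]
      two_Re_cinner_projector_compl_le[OF P(3), of b v]
    by (simp add: b_def x_def)
  \<comment> \<open>The squared norm of \<open>b\<close> cancels, and that of \<open>x\<close>
    enters negatively and is dropped.\<close>
  finally have "(norm a)\<^sup>2 + (norm (P2 v))\<^sup>2 + (norm (P3 v))\<^sup>2 - 2 * (norm v)\<^sup>2 \<le> 2 * Re (cinner x v)"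
    using zero_le_power2[of "norm x"] by linarith
  then have "s * ((norm a)\<^sup>2 + (norm (P2 v))\<^sup>2 + (norm (P3 v))\<^sup>2 - 2 * (norm v)\<^sup>2)
      \<le> s * (2 * Re (cinner x v))"
    using \<open>0 \<le> s\<close> by (rule mult_left_mono)
  also have "\<dots> = 2 * Re (cinner x (s *\<^sub>R v))"
    by (simp add: cinner.scaleR_right)
  also have "\<dots> \<le> (norm x)\<^sup>2 + s\<^sup>2 * (norm v)\<^sup>2"
    using two_Re_cinner_le[of x "s *\<^sub>R v"] by (simp add: power_mult_distrib)
  finally show ?thesis by (simp add: a_def b_def x_def)
qed

text \<open>
  Encodes \<open>\<sigma> = \<Sum>\<^sub>i |\<psi>\<^sub>i\<rangle>\<langle>\<psi>\<^sub>i|\<close> in the form \<open>tr (A \<sigma> C) = \<Sum>\<^sub>i \<langle>C\<^sup>* \<psi>\<^sub>i, A \<psi>\<^sub>i\<rangle>\<close>, with the adjoints of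
  \<open>A\<close> and \<open>C\<close> supplied as \<open>A'\<close> and \<open>C'\<close>.
\<close>

definition vector_ensemble ::
    "('a::chilbert_space \<Rightarrow>\<^sub>L 'a) \<Rightarrow> 'a set \<Rightarrow> ('a \<Rightarrow> 'a) \<Rightarrow> bool"
  where "vector_ensemble \<sigma> I \<psi> \<longleftrightarrow>
    ((\<lambda>i. (norm (\<psi> i))\<^sup>2) has_sum 1) I \<and>
    (\<forall>(A :: 'a \<Rightarrow>\<^sub>L 'a) A' C C'. (\<forall>x y. cinner (blinfun_apply A x) y = cinner x (blinfun_apply A' y)) \<longrightarrow>
      (\<forall>x y. cinner (blinfun_apply C x) y = cinner x (blinfun_apply C' y)) \<longrightarrow>
      ((\<lambda>i. cinner (C' (\<psi> i)) (A (\<psi> i))) has_sum tr (A o\<^sub>L \<sigma> o\<^sub>L C)) I)"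

lemma vector_ensemble_has_sum_norm:
  "vector_ensemble \<sigma> I \<psi> \<Longrightarrow> ((\<lambda>i. (norm (\<psi> i))\<^sup>2) has_sum 1) I"
  by (simp add: vector_ensemble_def)

lemma vector_ensemble_has_sum_tr:
  fixes A A' C C' :: "'a::chilbert_space \<Rightarrow>\<^sub>L 'a"
  assumes "vector_ensemble \<sigma> I \<psi>" "\<And>x y. cinner (A x) y = cinner x (A' y)"
    "\<And>x y. cinner (C x) y = cinner x (C' y)"
  shows "((\<lambda>i. cinner (C' (\<psi> i)) (A (\<psi> i))) has_sum tr (A o\<^sub>L \<sigma> o\<^sub>L C)) I"
  using assms unfolding vector_ensemble_def by blast

lemma quantum_state_ensemble:
  fixes \<sigma> :: "'a::chilbert_space \<Rightarrow>\<^sub>L 'a"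
  assumes "quantum_state \<sigma>"
  obtains B \<psi> where "vector_ensemble \<sigma> B \<psi>"
proof -
  have pos: "positive_semidefinite \<sigma>" and tr1: "tr \<sigma> = 1"
    using assms by (simp_all add: quantum_state_def)
  obtain R where sq: "\<And>x. R (R x) = \<sigma> x" and sa: "\<And>x y. cinner (R x) y = cinner x (R y)"
    using positive_semidefinite_sqrt[OF pos] by blast
  define B where "B = (SOME B :: 'a set. orthonormal_basis B)"
  have eq: "cinner b (\<sigma> b) = complex_of_real ((norm (R b))\<^sup>2)" for b
    by (metis cinner_self sa sq)
  \<comment> \<open>A divergent trace sum would have value 0, not 1.\<close>
  have "(\<lambda>b. cinner b (\<sigma> b)) summable_on B"
    using tr1 unfolding tr_def B_def[symmetric] by (metis infsum_not_exists zero_neq_one)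
  then have "((\<lambda>b. cinner b (\<sigma> b)) has_sum 1) B"
    using tr1 unfolding tr_def B_def[symmetric] by (metis has_sum_infsum)
  then have "((\<lambda>b. complex_of_real ((norm (R b))\<^sup>2)) has_sum complex_of_real 1) B"
    unfolding eq by simp
  then have norm1: "((\<lambda>b. (norm (R b))\<^sup>2) has_sum 1) B"
    by (simp only: has_sum_of_real_iff)
  then have summ: "(\<lambda>b. (norm (R b))\<^sup>2) summable_on (SOME B. orthonormal_basis B)"
    unfolding B_def by (rule has_sum_imp_summable)
  have "((\<lambda>b. cinner (C' (R b)) (A (R b))) has_sum tr (A o\<^sub>L \<sigma> o\<^sub>L C)) B"
    if "\<And>x y. cinner (blinfun_apply A x) y = cinner x (blinfun_apply A' y)"
      and "\<And>x y. cinner (blinfun_apply C x) y = cinner x (blinfun_apply C' y)"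
    for A A' C C' :: "'a \<Rightarrow>\<^sub>L 'a"
    unfolding B_def by (rule trace_sandwich[OF sq sa summ that])
  with norm1 have "vector_ensemble \<sigma> B R" by (simp add: vector_ensemble_def)
  then show ?thesis by (rule that)
qed

section \<open>Refining the projectors into their summands\<close>

lemma norm_sum_sqr_le:
  fixes f :: "'i \<Rightarrow> 'a::real_normed_vector"
  shows "(norm (\<Sum>i\<in>I. f i))\<^sup>2 \<le> real (card I) * (\<Sum>i\<in>I. (norm (f i))\<^sup>2)"
proof -
  have "(norm (\<Sum>i\<in>I. f i))\<^sup>2 \<le> (\<Sum>i\<in>I. norm (f i))\<^sup>2"
    by (intro power_mono norm_sum) simp
  also have "\<dots> \<le> (\<Sum>i\<in>I. (norm (f i))\<^sup>2) * real (card I)"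
    by (rule sum_squared_le_sum_of_squares)
  finally show ?thesis by (simp add: mult.commute)
qed

text \<open>The squared norm of \<open>P x\<close> equals <x, P x>, which is linear in
  \<open>P\<close>.\<close>

lemma norm_projector_sum:
  assumes P: "projector P" and Q: "\<And>s. s \<in> I \<Longrightarrow> projector (Q s)" and sum: "P = (\<Sum>s\<in>I. Q s)"
  shows "(\<Sum>s\<in>I. (norm (Q s x))\<^sup>2) = (norm (P x))\<^sup>2"
proof -
  have "P x = (\<Sum>s\<in>I. Q s x)"
    by (simp add: sum blinfun.sum_left)
  then have "complex_of_real ((norm (P x))\<^sup>2) = (\<Sum>s\<in>I. cinner x (Q s x))"
    by (metis cinner_projector[OF P] cinner.sum_right)
  also have "\<dots> = complex_of_real (\<Sum>s\<in>I. (norm (Q s x))\<^sup>2)"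
    using Q by (simp add: cinner_projector)
  finally show ?thesis by (simp only: of_real_eq_iff)
qed

text \<open>Cauchy-Schwarz over the pairs (s2, s1) costs the cardinality factor; \<open>P3\<close>
  stands outermost and splits exactly by \<open>norm_projector_sum\<close>, at no cost.\<close>

lemma norm_projector_triple_le_sum:
  fixes P1 P2 P3 :: "'a::chilbert_space \<Rightarrow>\<^sub>L 'a" and Q1 Q2 Q3 :: "'i \<Rightarrow> 'a \<Rightarrow>\<^sub>L 'a"
  assumes P3: "projector P3" "\<And>s. s \<in> I3 \<Longrightarrow> projector (Q3 s)" "P3 = (\<Sum>s\<in>I3. Q3 s)"
    and P2: "P2 = (\<Sum>s\<in>I2. Q2 s)" and P1: "P1 = (\<Sum>s\<in>I1. Q1 s)"
  shows "(norm (P3 (P2 (P1 v))))\<^sup>2 \<le> real (card I2 * card I1) *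
    (\<Sum>s3\<in>I3. \<Sum>s2\<in>I2. \<Sum>s1\<in>I1. (norm (Q3 s3 (Q2 s2 (Q1 s1 v))))\<^sup>2)"
proof -
  have "P3 (P2 (P1 v)) = (\<Sum>s1\<in>I1. \<Sum>s2\<in>I2. P3 (Q2 s2 (Q1 s1 v)))"
    by (simp add: P1 P2 blinfun.sum_left blinfun.sum_right)
  also have "\<dots> = (\<Sum>s2\<in>I2. \<Sum>s1\<in>I1. P3 (Q2 s2 (Q1 s1 v)))"
    by (rule sum.swap)
  also have "\<dots> = (\<Sum>p\<in>I2 \<times> I1. P3 (Q2 (fst p) (Q1 (snd p) v)))"
    by (simp add: sum.cartesian_product case_prod_unfold)
  finally have "(norm (P3 (P2 (P1 v))))\<^sup>2
      \<le> real (card (I2 \<times> I1)) * (\<Sum>p\<in>I2 \<times> I1. (norm (P3 (Q2 (fst p) (Q1 (snd p) v))))\<^sup>2)"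
    by (simp only: norm_sum_sqr_le)
  also have "(\<Sum>p\<in>I2 \<times> I1. (norm (P3 (Q2 (fst p) (Q1 (snd p) v))))\<^sup>2)
      = (\<Sum>p\<in>I2 \<times> I1. \<Sum>s3\<in>I3. (norm (Q3 s3 (Q2 (fst p) (Q1 (snd p) v))))\<^sup>2)"
    by (simp only: norm_projector_sum[OF P3])
  also have "\<dots> = (\<Sum>s3\<in>I3. \<Sum>s2\<in>I2. \<Sum>s1\<in>I1. (norm (Q3 s3 (Q2 s2 (Q1 s1 v))))\<^sup>2)"
    by (subst sum.swap) (simp add: sum.cartesian_product case_prod_unfold)
  finally show ?thesis by (simp only: card_cartesian_product)
qed

lemma projector_sandwich_has_sum:
  fixes \<sigma> P1 P2 P3 :: "'a::chilbert_space \<Rightarrow>\<^sub>L 'a"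
  assumes ens: "vector_ensemble \<sigma> B \<psi>"
    and P: "projector P1" "projector P2" "projector P3"
  shows "((\<lambda>b. (norm (P3 (P2 (P1 (\<psi> b)))))\<^sup>2)
    has_sum Re (tr (P3 o\<^sub>L P2 o\<^sub>L P1 o\<^sub>L \<sigma> o\<^sub>L P1 o\<^sub>L P2))) B"
proof -
  have "((\<lambda>b. cinner ((P2 o\<^sub>L P1) (\<psi> b)) ((P3 o\<^sub>L P2 o\<^sub>L P1) (\<psi> b)))
      has_sum tr ((P3 o\<^sub>L P2 o\<^sub>L P1) o\<^sub>L \<sigma> o\<^sub>L (P1 o\<^sub>L P2))) B"
    \<comment> \<open>The operator to the right of \<sigma> is \<open>P1 o\<^sub>L P2\<close>, with
      adjoint \<open>P2 o\<^sub>L P1\<close>; the single \<open>P3\<close> then acts as <y, P3 y>, a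
      squared norm.\<close>
    by (rule vector_ensemble_has_sum_tr[OF ens, of _ "P1 o\<^sub>L P2 o\<^sub>L P3"]) (simp_all add: projector_adjoint P)
  moreover have "(P3 o\<^sub>L P2 o\<^sub>L P1) o\<^sub>L \<sigma> o\<^sub>L (P1 o\<^sub>L P2)
      = P3 o\<^sub>L P2 o\<^sub>L P1 o\<^sub>L \<sigma> o\<^sub>L P1 o\<^sub>L P2"
    by (rule blinfun_eqI) simp
  ultimately have "((\<lambda>b. cinner ((P2 o\<^sub>L P1) (\<psi> b)) ((P3 o\<^sub>L P2 o\<^sub>L P1) (\<psi> b)))
      has_sum tr (P3 o\<^sub>L P2 o\<^sub>L P1 o\<^sub>L \<sigma> o\<^sub>L P1 o\<^sub>L P2)) B"
    by simp
  from has_sum_Re[OF this] show ?thesis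
    by (simp add: cinner_projector P)
qed

text \<open>The hypothesis \<open>V_ge\<close> does not appear in the informal statement, which
  fails without it: if all projectors are 0, then V = E = 0 while the right-hand side is 8 / (9 S1
  S2) > 0. Taking real parts loses nothing, as these traces are sums of squared norms.\<close>

theorem proposition2:
  fixes P :: "nat \<Rightarrow> ('a::chilbert_space \<Rightarrow>\<^sub>L 'a)"
    and Q :: "nat \<Rightarrow> nat \<Rightarrow> ('a \<Rightarrow>\<^sub>L 'a)"
    and S :: "nat \<Rightarrow> nat"
    and \<sigma> :: "'a \<Rightarrow>\<^sub>L 'a"
    and V E :: real
  assumes S_pos: "\<And>i. i \<in> {1, 2, 3} \<Longrightarrow> 1 \<le> S i"
    and P_proj: "\<And>i. i \<in> {1, 2, 3} \<Longrightarrow> projector (P i)"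
    and P_sum: "\<And>i. i \<in> {1, 2, 3} \<Longrightarrow> P i = (\<Sum>s = 1..S i. Q i s)"
    and Q_proj: "\<And>i s. i \<in> {1, 2, 3} \<Longrightarrow> s \<in> {1..S i} \<Longrightarrow> projector (Q i s)"
    and Q_orth: "\<And>i s s'. i \<in> {1, 2, 3} \<Longrightarrow> s \<in> {1..S i} \<Longrightarrow> s' \<in> {1..S i} \<Longrightarrow>
      Q i s o\<^sub>L Q i s' = (if s = s' then Q i s else 0)"
    and state: "quantum_state \<sigma>"
    and V_eq: "V = 1 / 3 * (\<Sum>i = 1..3. Re (tr (P i o\<^sub>L \<sigma>)))"
    and E_eq: "E = 1 / 2 *
      ((\<Sum>s3 = 1..S 3. \<Sum>s2 = 1..S 2. \<Sum>s1 = 1..S 1.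
          Re (tr (Q 3 s3 o\<^sub>L Q 2 s2 o\<^sub>L Q 1 s1 o\<^sub>L \<sigma> o\<^sub>L Q 1 s1 o\<^sub>L Q 2 s2)))
     + (\<Sum>s3 = 1..S 3. \<Sum>s2 = 1..S 2. \<Sum>s1 = 1..S 1.
          Re (tr (Q 3 s3 o\<^sub>L Q 1 s1 o\<^sub>L Q 2 s2 o\<^sub>L \<sigma> o\<^sub>L Q 2 s2 o\<^sub>L Q 1 s1))))"
    and V_ge: "2 / 3 \<le> V"
  shows "E \<ge> 9 * (V - 2 / 3) ^ 4 / (2 * real (S 1) * real (S 2))"
proof -
  obtain B \<psi> where ens: "vector_ensemble \<sigma> B \<psi>"
    using quantum_state_ensemble[OF state] by blast
  note norm1 = vector_ensemble_has_sum_norm[OF ens]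
  define p where "p i = Re (tr (P i o\<^sub>L \<sigma>))" for i
  have p: "((\<lambda>b. (norm (P i (\<psi> b)))\<^sup>2) has_sum p i) B" if "i \<in> {1, 2, 3}" for i
  proof -
    have "((\<lambda>b. cinner (id_blinfun (\<psi> b)) (P i (\<psi> b))) has_sum tr (P i o\<^sub>L \<sigma> o\<^sub>L id_blinfun)) B"
      by (rule vector_ensemble_has_sum_tr[OF ens, of _ "P i"]) (simp_all add: projector_adjoint[OF P_proj[OF that]])
    moreover have "P i o\<^sub>L \<sigma> o\<^sub>L id_blinfun = P i o\<^sub>L \<sigma>"
      by (rule blinfun_eqI) simp
    ultimately have "((\<lambda>b. cinner (\<psi> b) (P i (\<psi> b))) has_sum tr (P i o\<^sub>L \<sigma>)) B"
      by simp
    from has_sum_Re[OF this] show ?thesis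
      by (simp add: p_def cinner_projector[OF P_proj[OF that]])
  qed
  define t where "t = p 1 + p 2 + p 3 - 2"
  have "{1..3::nat} = {1, 2, 3}" by auto
  then have Vt: "V - 2 / 3 = t / 3"
    by (simp add: V_eq t_def p_def)
  then have "0 \<le> t" using V_ge by simp
  have "p i \<le> 1" if "i \<in> {1, 2, 3}" for i
    using has_sum_mono[OF p[OF that] norm1] norm_projector_le[OF P_proj[OF that]] by blast
  from this[of 1] this[of 2] this[of 3] have "t \<le> 1" by (simp add: t_def)
  \<comment> \<open>Both orders of the first two projectors, (1, 2) and (2, 1), are treated at
    once.\<close>
  have main: "t\<^sup>2 / 4 \<le> real (S i * S j) * (\<Sum>s3 = 1..S 3. \<Sum>sj = 1..S j. \<Sum>si = 1..S i.
      Re (tr (Q 3 s3 o\<^sub>L Q j sj o\<^sub>L Q i si o\<^sub>L \<sigma> o\<^sub>L Q i si o\<^sub>L Q j sj)))" (is "_ \<le> _ * ?T")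
    if ij: "{i, j} = {1, 2}" for i j
  proof -
    have i: "i \<in> {1, 2, 3}" and j: "j \<in> {1, 2, 3}" and p_eq: "p i + p j = p 1 + p 2"
      using ij by (auto simp: doubleton_eq_iff)
    note P3 = P_proj[of 3] Q_proj[of 3] P_sum[of 3]
    define T where "T b = (\<Sum>s3 = 1..S 3. \<Sum>sj = 1..S j. \<Sum>si = 1..S i.
      (norm (Q 3 s3 (Q j sj (Q i si (\<psi> b)))))\<^sup>2)" for b
    have T: "(T has_sum ?T) B"
      unfolding T_def
      by (intro has_sum_finite_sum projector_sandwich_has_sum[OF ens]) (use i j Q_proj in auto)
    \<comment> \<open>The weight \<open>s = t / 2\<close> maximises
      \<open>s * t - s\<^sup>2\<close>, with value \<open>t\<^sup>2 / 4\<close>. Differences are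
      written as sums to fit the rules for adding and scaling.\<close>
    have lhs: "((\<lambda>b. t / 2 * ((norm (P i (\<psi> b)))\<^sup>2 + (norm (P j (\<psi> b)))\<^sup>2 + (norm (P 3 (\<psi> b)))\<^sup>2
          + (- 2) * (norm (\<psi> b))\<^sup>2) + (- ((t / 2)\<^sup>2)) * (norm (\<psi> b))\<^sup>2)
        has_sum t / 2 * (p i + p j + p 3 + (- 2) * 1) + (- ((t / 2)\<^sup>2)) * 1) B"
      by (intro has_sum_add has_sum_cmult_right p norm1 i j) simp
    have rhs: "((\<lambda>b. real (S i * S j) * T b) has_sum real (S i * S j) * ?T) B"
      by (rule has_sum_cmult_right[OF T])
    have "t / 2 * (p i + p j + p 3 + (- 2) * 1) + (- ((t / 2)\<^sup>2)) * 1 \<le> real (S i * S j) * ?T"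
    proof (rule has_sum_mono[OF lhs rhs])
      fix b
      have "(norm (P 3 (P j (P i (\<psi> b)))))\<^sup>2 \<le> real (card {1..S j} * card {1..S i}) * T b"
        unfolding T_def using P3 P_sum[OF j] P_sum[OF i]
        by (intro norm_projector_triple_le_sum) auto
      moreover have "t / 2 * ((norm (P i (\<psi> b)))\<^sup>2 + (norm (P j (\<psi> b)))\<^sup>2 + (norm (P 3 (\<psi> b)))\<^sup>2
          - 2 * (norm (\<psi> b))\<^sup>2) - (t / 2)\<^sup>2 * (norm (\<psi> b))\<^sup>2 \<le> (norm (P 3 (P j (P i (\<psi> b)))))\<^sup>2"
        using P_proj i j \<open>0 \<le> t\<close> by (intro norm_projector_triple_ge) auto
      ultimately show "t / 2 * ((norm (P i (\<psi> b)))\<^sup>2 + (norm (P j (\<psi> b)))\<^sup>2 + (norm (P 3 (\<psi> b)))\<^sup>2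
          + (- 2) * (norm (\<psi> b))\<^sup>2) + (- ((t / 2)\<^sup>2)) * (norm (\<psi> b))\<^sup>2 \<le> real (S i * S j) * T b"
        by (simp add: mult.commute)
    qed
    moreover have "t / 2 * (p i + p j + p 3 + (- 2) * 1) + (- ((t / 2)\<^sup>2)) * 1 = t\<^sup>2 / 4"
    proof -
      have "p i + p j + p 3 + (- 2) * 1 = t" using p_eq by (simp add: t_def)
      then show ?thesis by (simp only:) (simp add: power2_eq_square)
    qed
    ultimately show ?thesis by linarith
  qed
  have S: "0 < real (S 1)" "0 < real (S 2)" using S_pos[of 1] S_pos[of 2] by auto
  \<comment> \<open>In the second half of \<open>E\<close> the sum over \<open>s2\<close> stands
    outside that over \<open>s1\<close>, the reverse of \<open>main\<close> for (2, 1).\<close>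
  have swap: "(\<Sum>s3 = 1..S 3. \<Sum>s2 = 1..S 2. \<Sum>s1 = 1..S 1. f s3 s2 s1)
      = (\<Sum>s3 = 1..S 3. \<Sum>s1 = 1..S 1. \<Sum>s2 = 1..S 2. f s3 s2 s1)" for f :: "nat \<Rightarrow> nat \<Rightarrow> nat \<Rightarrow> real"
    by (intro sum.cong refl sum.swap)
  have E2: "2 * E = (\<Sum>s3 = 1..S 3. \<Sum>s2 = 1..S 2. \<Sum>s1 = 1..S 1.
          Re (tr (Q 3 s3 o\<^sub>L Q 2 s2 o\<^sub>L Q 1 s1 o\<^sub>L \<sigma> o\<^sub>L Q 1 s1 o\<^sub>L Q 2 s2)))
     + (\<Sum>s3 = 1..S 3. \<Sum>s1 = 1..S 1. \<Sum>s2 = 1..S 2.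
          Re (tr (Q 3 s3 o\<^sub>L Q 1 s1 o\<^sub>L Q 2 s2 o\<^sub>L \<sigma> o\<^sub>L Q 2 s2 o\<^sub>L Q 1 s1)))"
    unfolding E_eq by (subst (2) swap) simp
  have "t\<^sup>2 / 4 + t\<^sup>2 / 4 \<le> real (S 1 * S 2) * (2 * E)"
    using main[of 1 2] main[of 2 1] unfolding E2
    by (simp add: distrib_left mult.commute insert_commute)
  then have "t\<^sup>2 / 2 \<le> 2 * real (S 1) * real (S 2) * E"
    by (simp add: mult_ac)
  moreover have "t ^ 4 \<le> t\<^sup>2"
    using \<open>0 \<le> t\<close> \<open>t \<le> 1\<close> by (intro power_decreasing) auto
  moreover have "0 \<le> t\<^sup>2" by simp
  ultimately have "t ^ 4 / 9 \<le> 2 * real (S 1) * real (S 2) * E" by linarith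
  moreover have "9 * (V - 2 / 3) ^ 4 = t ^ 4 / 9"
    unfolding Vt by (simp add: power_divide)
  ultimately show ?thesis
    using S by (simp add: field_simps)
qed

end
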